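(* Let $(X,\mu)$ be a non-atomic Lebesgue space with a positive finite or $\sigma$-finite measure. Any ergodic, nonsingular, measurably sensitive transformation $T:X\to X$ has finitely many eigenvalues.
   Context: $T$ is nonsingular if it is measurable and, for measurable $A$, $\mu(A)=0$ if and only if $\mu(T^{-1}(A))=0$. A number $\lambda\in\mathbb{C}$ is an ($L^\infty$) eigenvalue of $T$ if there is an a.e. nonzero $f\in L^\infty$ such that $f\circ T=\lambda f$ a.e. A metric $d$ on a measure space is good if all nonempty open sets have positive measure; when a space carries a good metric, the measure on it is assumed to be regular (so open sets are measurable). $B_\varepsilon(x)$ denotes the open $d$-ball of radius $\varepsilon$ about $x$. Two systems $(X,\mu,T)$ and $(X_1,\mu_1,T_1)$ are measure-theoretically isomorphic if, after discarding null sets (with forward-invariant complements), there is a bimeasurable bijection between them that carries $\mu$ to $\mu_1$ and intertwines $T$ and $T_1$. $T$ is measurably sensitive if whenever $(X_1,\mu_1,T_1)$ is measure-theoretically isomorphic to $(X,\mu,T)$ and $d$ is a good metric on $X_1$, there exists $\delta>0$ such that for all $x\in X_1$ and all $\varepsilon>0$ there exists $N\in\mathbb{N}$ such that for all integers $n\ge N$, $\mu_1\{y\in B_\varepsilon(x): d(T_1^n(x),T_1^n(y))>\delta\}>0$. *)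

theory Defs
  imports "HOL-Analysis.Analysis"
begin

definition nonsingular :: "'a measure \<Rightarrow> ('a \<Rightarrow> 'a) \<Rightarrow> bool" where
  "nonsingular M T \<longleftrightarrow>
     T \<in> measurable M M \<and>
     (\<forall>A\<in>sets M. emeasure M A = 0 \<longleftrightarrow> emeasure M (T -` A \<inter> space M) = 0)"

definition ergodic :: "'a measure \<Rightarrow> ('a \<Rightarrow> 'a) \<Rightarrow> bool" where
  "ergodic M T \<longleftrightarrow>
     (\<forall>A\<in>sets M. T -` A \<inter> space M = A \<longrightarrow>
        emeasure M A = 0 \<or> emeasure M (space M - A) = 0)"

text \<open>The second and third conjuncts say that \<open>f\<close> is in \<open>L\<^sup>\<infinity>\<close>.\<close>

definition eigenvalue :: "'a measure \<Rightarrow> ('a \<Rightarrow> 'a) \<Rightarrow> complex \<Rightarrow> bool" where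
  "eigenvalue M T l \<longleftrightarrow>
     (\<exists>f :: 'a \<Rightarrow> complex.
        (AE x in M. f x \<noteq> 0) \<and>
        f \<in> borel_measurable M \<and>
        (\<exists>C. AE x in M. cmod (f x) \<le> C) \<and>
        (AE x in M. f (T x) = l * f x))"

definition iso_mod_null ::
    "'a measure \<Rightarrow> 'b measure \<Rightarrow> 'a set \<Rightarrow> 'b set \<Rightarrow> ('a \<Rightarrow> 'b) \<Rightarrow> bool" where
  "iso_mod_null M N X Y \<phi> \<longleftrightarrow>
     X \<in> sets M \<and> space M - X \<in> null_sets M \<and>
     Y \<in> sets N \<and> space N - Y \<in> null_sets N \<and>
     bij_betw \<phi> X Y \<and>
     \<phi> \<in> measurable (restrict_space M X) (restrict_space N Y) \<and>
     the_inv_into X \<phi> \<in> measurable (restrict_space N Y) (restrict_space M X) \<and>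
     distr (restrict_space M X) (restrict_space N Y) \<phi> = restrict_space N Y"

text \<open>
  A Lebesgue space is a complete measure space that is isomorphic, modulo null sets, to an
  interval with Lebesgue measure together with countably many atoms.  Here \<open>C\<close> is the set of
  atoms; the interval may be unbounded or empty.
\<close>

definition lebesgue_space :: "'a measure \<Rightarrow> bool" where
  "lebesgue_space M \<longleftrightarrow>
     complete_measure M \<and>
     (\<exists>C. countable C \<and> (\<forall>c\<in>C. {c} \<in> sets M \<and> emeasure M {c} > 0) \<and>
        (\<exists>(I :: real set) X Y \<phi>. is_interval I \<and>
           iso_mod_null (restrict_space M (space M - C)) (lebesgue_on I) X Y \<phi>))"

definition nonatomic :: "'a measure \<Rightarrow> bool" where
  "nonatomic M \<longleftrightarrow>
     (\<forall>A\<in>sets M. emeasure M A > 0 \<longrightarrow>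
        (\<exists>B\<in>sets M. B \<subseteq> A \<and> emeasure M B > 0 \<and> emeasure M (A - B) > 0))"

definition isomorphic_systems ::
    "'a measure \<Rightarrow> ('a \<Rightarrow> 'a) \<Rightarrow> 'b measure \<Rightarrow> ('b \<Rightarrow> 'b) \<Rightarrow> bool" where
  "isomorphic_systems M T N S \<longleftrightarrow>
     (\<exists>X Y \<phi>. iso_mod_null M N X Y \<phi> \<and> T ` X \<subseteq> X \<and> S ` Y \<subseteq> Y \<and>
        (\<forall>x\<in>X. \<phi> (T x) = S (\<phi> x)))"

text \<open>The \<open>\<sigma>\<close>-algebra may be larger than the Borel one, for instance its completion.\<close>

definition regular_wrt :: "'a measure \<Rightarrow> ('a \<Rightarrow> 'a \<Rightarrow> real) \<Rightarrow> bool" where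
  "regular_wrt M d \<longleftrightarrow>
     (let \<tau> = Metric_space.mtopology (space M) d in
       (\<forall>U. openin \<tau> U \<longrightarrow> U \<in> sets M) \<and>
       (\<forall>A\<in>sets M.
          emeasure M A = (INF U\<in>{U. openin \<tau> U \<and> A \<subseteq> U}. emeasure M U) \<and>
          emeasure M A = (SUP K\<in>{K. compactin \<tau> K \<and> K \<subseteq> A}. emeasure M K)))"

definition good_metric :: "'a measure \<Rightarrow> ('a \<Rightarrow> 'a \<Rightarrow> real) \<Rightarrow> bool" where
  "good_metric M d \<longleftrightarrow>
     Metric_space (space M) d \<and> regular_wrt M d \<and>
     (\<forall>U. openin (Metric_space.mtopology (space M) d) U \<and> U \<noteq> {} \<longrightarrow> emeasure M U > 0)"

text \<open>
  HOL cannot quantify over the type of the isomorphic copy \<open>N\<close>, so \<open>N\<close> lives on the type of \<open>M\<close>.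
  If \<open>M\<close> is a non-atomic, \<open>\<sigma>\<close>-finite Lebesgue space of positive measure this loses nothing: a
  good metric on a \<open>\<sigma>\<close>-finite measure space is separable (disjoint nonempty open sets have
  positive measure, so there are only countably many), hence a space carrying one has at most
  the cardinality of the continuum, and \<open>'a\<close> has at least that cardinality.
\<close>

definition measurably_sensitive :: "'a measure \<Rightarrow> ('a \<Rightarrow> 'a) \<Rightarrow> bool" where
  "measurably_sensitive M T \<longleftrightarrow>
     (\<forall>(N :: 'a measure) S d.
        S \<in> measurable N N \<and> isomorphic_systems M T N S \<and> good_metric N d \<longrightarrow>
        (\<exists>\<delta>>0. \<forall>x\<in>space N. \<forall>\<epsilon>>0. \<exists>n0. \<forall>n\<ge>n0.
           emeasure N {y \<in> Metric_space.mball (space N) d x \<epsilon>.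
             d ((S ^^ n) x) ((S ^^ n) y) > \<delta>} > 0))"

end

theory Submission
  imports Defs
begin

text \<open>
  Suppose that there are infinitely many eigenvalues.  They have modulus one, so for a sequence of
  distinct ones \<open>l i\<close> with bounded eigenfunctions \<open>f i\<close> Dirichlet's theorem gives infinitely many
  \<open>n\<close> with \<open>(l i) ^ n\<close> simultaneously close to 1.  Hence an absolutely convergent combination \<open>h\<close>
  of the \<open>f i\<close> is moved very little by \<open>T ^^ n\<close> for infinitely many \<open>n\<close>.  If \<open>h\<close> had only finitely
  many essential values, it would be invariant under some \<open>T ^^ n\<close>, and Cesaro averaging would
  force \<open>(l i) ^ n = 1\<close> for all \<open>i\<close>.  So the essential values of \<open>h\<close> accumulate at some \<open>z\<close>.  Put
  \<open>u x = dist (h x) z\<close> and choose a metric that shrinks the shells \<open>1 / (i + 1) < u \<le> 1 / i\<close> so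
  much that \<open>{x. 0 < u x \<and> u x < r}\<close> has diameter at most \<open>r\<close>, while each shell is open and
  carries the topology of the line.  A small ball in a deep shell stays, for infinitely many \<open>n\<close>,
  in shells that are nearly as deep, so \<open>T\<close> is not sensitive for this metric.
\<close>

subsection \<open>Nonsingular maps and eigenvalues\<close>

lemma nonsingular_AE:
  assumes "nonsingular M T" and "AE x in M. P x"
  shows "AE x in M. P (T x)"
proof -
  obtain A where A: "{x \<in> space M. \<not> P x} \<subseteq> A" "emeasure M A = 0" "A \<in> sets M"
    using assms(2) by (rule AE_E)
  have T: "T \<in> measurable M M" and "emeasure M (T -` A \<inter> space M) = 0"
    using assms(1) A unfolding nonsingular_def by auto
  then have "T -` A \<inter> space M \<in> null_sets M"
    using A(3) by auto
  moreover have "{x \<in> space M. \<not> P (T x)} \<subseteq> T -` A \<inter> space M"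
    using A(1) measurable_space[OF T] by auto
  ultimately show ?thesis
    by (rule AE_I')
qed

lemma nonsingular_AE_funpow:
  assumes "nonsingular M T" and "AE x in M. P x"
  shows "AE x in M. P ((T ^^ n) x)"
proof (induction n)
  case 0
  then show ?case using assms(2) by simp
next
  case (Suc n)
  have "AE x in M. P ((T ^^ n) (T x))"
    by (rule nonsingular_AE[OF assms(1) Suc])
  then show ?case by (simp add: funpow_swap1)
qed

text \<open>Discarding a null set need not leave a forward invariant set, as isomorphism of systems
  demands. So every point whose orbit ever meets a measurable null set containing the exceptions is
  discarded; this is a countable union of null preimages.\<close>

lemma nonsingular_forward_invariant_set:
  assumes ns: "nonsingular M T" and P: "AE x in M. P x"
  obtains Z where "Z \<in> sets M" "space M - Z \<in> null_sets M" "T ` Z \<subseteq> Z" "\<And>x. x \<in> Z \<Longrightarrow> P x"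
proof -
  obtain A where A: "{x \<in> space M. \<not> P x} \<subseteq> A" "emeasure M A = 0" "A \<in> sets M"
    using P by (rule AE_E)
  have T: "T \<in> measurable M M"
    using ns unfolding nonsingular_def by simp
  define Z where "Z = {x \<in> space M. \<forall>n. (T ^^ n) x \<in> space M - A}"
  have Tn: "(T ^^ n) \<in> measurable M M" for n
    using T by (rule measurable_compose_n)
  have Z: "Z \<in> sets M"
    unfolding Z_def using A(3) Tn by measurable
  have "AE x in M. x \<in> space M - A"
    using A AE_not_in[of A M] AE_space[of M] by (auto simp: null_setsI)
  then have "AE x in M. \<forall>n. (T ^^ n) x \<in> space M - A"
    unfolding AE_all_countable using nonsingular_AE_funpow[OF ns] by blast
  then have "AE x in M. x \<in> Z"
    unfolding Z_def using AE_space by eventually_elim auto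
  then have "space M - Z \<in> null_sets M"
    using Z by (subst (asm) AE_iff_null) (auto simp: set_diff_eq)
  moreover have "T ` Z \<subseteq> Z"
  proof (clarsimp simp: Z_def, intro conjI allI)
    fix x assume x: "x \<in> space M" "\<forall>n. (T ^^ n) x \<in> space M \<and> (T ^^ n) x \<notin> A"
    show "T x \<in> space M" using x(1) T by (rule measurable_space[rotated])
    fix n
    show "(T ^^ n) (T x) \<in> space M" "(T ^^ n) (T x) \<notin> A"
      using x(2)[rule_format, of "Suc n"] by (auto simp: funpow_swap1)
  qed
  moreover have "P x" if "x \<in> Z" for x
  proof -
    have "(T ^^ 0) x \<in> space M - A"
      using that unfolding Z_def by blast
    then show ?thesis using A(1) by auto
  qed
  ultimately show thesis using that Z by blast
qed

text \<open>If \<open>cmod l < 1\<close>, an essential bound for \<open>f\<close> improves by the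
  factor \<open>cmod l\<close> on \<open>f o T\<close>. Sets with null preimage are null, so the
  improved bound holds for \<open>f\<close> itself, and iterating forces \<open>f = 0\<close>. If
  \<open>cmod l > 1\<close>, then \<open>cmod f\<close> grows along almost every orbit beyond its
  essential bound.\<close>

lemma eigenvalue_norm:
  assumes ns: "nonsingular M T" and pos: "emeasure M (space M) > 0" and ev: "eigenvalue M T l"
  shows "cmod l = 1"
proof -
  obtain f C where f: "AE x in M. f x \<noteq> 0" "f \<in> borel_measurable M"
    "AE x in M. cmod (f x) \<le> C" "AE x in M. f (T x) = l * f x"
    using ev unfolding eigenvalue_def by blast
  have nonfalse: "\<not> (AE x in M. False)"
    using pos AE_iff_null[of M "\<lambda>_. False"] by auto
  have "\<not> cmod l < 1"
  proof
    assume l: "cmod l < 1"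
    have "AE x in M. cmod (f x) \<le> C * cmod l ^ k" for k
    proof (induction k)
      case 0
      then show ?case using f(3) by simp
    next
      case (Suc k)
      define A where "A = {x \<in> space M. cmod (f x) > C * cmod l ^ Suc k}"
      have A: "A \<in> sets M"
        unfolding A_def using f(2) by measurable
      have T: "T \<in> measurable M M"
        using ns unfolding nonsingular_def by simp
      have "AE x in M. \<not> C * cmod l ^ Suc k < cmod (f (T x))"
        using Suc f(4)
      proof eventually_elim
        case (elim x)
        then show ?case
          using mult_left_mono[OF elim(1), of "cmod l"] by (simp add: norm_mult mult_ac)
      qed
      then have "AE x in M. x \<notin> T -` A \<inter> space M"
        by eventually_elim (auto simp: A_def)
      then have "emeasure M (T -` A \<inter> space M) = 0"
        using AE_iff_measurable[of "T -` A \<inter> space M" M "\<lambda>x. x \<notin> T -` A \<inter> space M"] A T by auto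
      then have "A \<in> null_sets M"
        using ns A unfolding nonsingular_def by auto
      from AE_not_in[OF this] AE_space show ?case
        by eventually_elim (auto simp: A_def not_less)
    qed
    then have "AE x in M. \<forall>k. cmod (f x) \<le> C * cmod l ^ k"
      by (simp add: AE_all_countable)
    then have "AE x in M. False"
      using f(1)
    proof eventually_elim
      case (elim x)
      have "(\<lambda>k. C * cmod l ^ k) \<longlonglongrightarrow> C * 0"
        using l by (intro tendsto_intros LIMSEQ_power_zero) simp
      then have "cmod (f x) \<le> C * 0"
        using elim by (intro LIMSEQ_le_const) auto
      then show ?case using elim by simp
    qed
    then show False using nonfalse by simp
  qed
  moreover have "\<not> cmod l > 1"
  proof
    assume l: "cmod l > 1"
    have "AE x in M. \<forall>n. cmod (f ((T ^^ n) x)) \<le> C \<and> f (T ((T ^^ n) x)) = l * f ((T ^^ n) x)"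
      unfolding AE_all_countable
      by (intro allI nonsingular_AE_funpow[OF ns, where P = "\<lambda>x. cmod (f x) \<le> C \<and> f (T x) = l * f x"])
        (use f in auto)
    then have "AE x in M. False"
      using f(1)
    proof eventually_elim
      case (elim x)
      have *: "f ((T ^^ n) x) = l ^ n * f x" for n
        using elim by (induction n) auto
      obtain n where "C / cmod (f x) < cmod l ^ n"
        using real_arch_pow[OF l] by blast
      then have "C < cmod (f ((T ^^ n) x))"
        using elim(2) by (simp add: * norm_mult norm_power field_simps)
      then show ?case using elim(1) by (metis not_less)
    qed
    then show False using nonfalse by simp
  qed
  ultimately show ?thesis by simp
qed

section \<open>Simultaneous recurrence of powers of unit complex numbers\<close>

lemma norm_cis_minus_one_le: "cmod (cis t - 1) \<le> \<bar>t\<bar>"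
  using dist_exp_i_1[of t] abs_sin_x_le_abs_x[of "t / 2"] by (simp add: cis_conv_exp)

text \<open>Dirichlet's theorem approximates the numbers \<open>Arg (l i) / (2 * pi)\<close> with
  one common denominator \<open>q\<close>. The integers \<open>p i\<close> contribute full turns, so
  \<open>l i ^ q\<close> is within \<open>2 * pi / N\<close> of 1, and \<open>N\<close> is chosen to
  make this less than \<open>e\<close>.\<close>

lemma unit_powers_simultaneously_near_one:
  fixes l :: "nat \<Rightarrow> complex"
  assumes "\<And>i. cmod (l i) = 1" and "e > 0"
  obtains q where "q \<ge> 1" "\<And>i. i < K \<Longrightarrow> cmod (l i ^ q - 1) < e"
proof -
  obtain N :: nat where N: "2 * pi / e < real N"
    using reals_Archimedean2 by blast
  moreover have "0 < 2 * pi / e" using assms(2) by simp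
  ultimately have "N > 0" by (metis less_trans of_nat_0_less_iff)
  obtain q p where q: "0 < q" and
    qp: "\<And>i. i < K \<Longrightarrow> \<bar>of_int q * (Arg (l i) / (2 * pi)) - of_int (p i)\<bar> < 1 / N"
    using Dirichlet_approx_simult[OF \<open>N > 0\<close>, of K "\<lambda>i. Arg (l i) / (2 * pi)"] by metis
  show thesis
  proof (rule that[of "nat q"])
    show "1 \<le> nat q" using q by simp
    fix i assume "i < K"
    let ?t = "real_of_int q * (Arg (l i) / (2 * pi)) - of_int (p i)"
    have "l i = cis (Arg (l i))"
      using assms(1)[of i] cis_Arg[of "l i"] by (cases "l i = 0") (auto simp: sgn_div_norm)
    then have "l i ^ nat q = cis (real (nat q) * Arg (l i))"
      using Complex.DeMoivre[of "Arg (l i)" "nat q"] by simp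
    also have "real (nat q) * Arg (l i) = 2 * pi * ?t + 2 * pi * of_int (p i)"
      using q by (simp add: field_simps)
    also have "cis \<dots> = cis (2 * pi * ?t)"
      by (simp flip: cis_mult add: cis_multiple_2pi)
    finally have "cmod (l i ^ nat q - 1) \<le> \<bar>2 * pi * ?t\<bar>"
      using norm_cis_minus_one_le[of "2 * pi * ?t"] by simp
    also have "\<dots> = 2 * pi * \<bar>?t\<bar>" by (simp add: abs_mult)
    also have "\<dots> < 2 * pi * (1 / N)"
      using qp[OF \<open>i < K\<close>] by (intro mult_strict_left_mono) auto
    also have "\<dots> < e"
      using N \<open>N > 0\<close> \<open>e > 0\<close> by (simp add: field_simps)
    finally show "cmod (l i ^ nat q - 1) < e" .
  qed
qed

text \<open>Each distance to 1 is at most 2, so a tail of \<open>c\<close> is negligible for all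
  exponents at once, and Dirichlet handles the finitely many remaining indices. Demanding
  \<open>n \<ge> 1\<close> excludes the trivial exponent 0.\<close>

lemma unit_weighted_recurrence:
  fixes l :: "nat \<Rightarrow> complex" and c :: "nat \<Rightarrow> real"
  assumes l: "\<And>i. cmod (l i) = 1" and c: "summable c" "\<And>i. c i \<ge> 0" and e: "e > 0"
  obtains n where "n \<ge> n0" "n \<ge> 1" "(\<Sum>i. c i * cmod (l i ^ n - 1)) < e"
proof -
  define D where "D n = (\<Sum>i. c i * cmod (l i ^ n - 1))" for n
  have le2: "cmod (l i ^ n - 1) \<le> 2" for i n
    using norm_triangle_ineq4[of "l i ^ n" 1] l by (simp add: norm_power)
  have sm: "summable (\<lambda>i. c i * cmod (l i ^ n - 1))" for n
    by (rule summable_comparison_test'[of "\<lambda>i. c i * 2"])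
      (use c le2 in \<open>auto intro!: summable_mult2 mult_left_mono\<close>)
  have small: "\<exists>q\<ge>1. D q < r" if r: "r > 0" for r
  proof -
    obtain K where K: "norm (\<Sum>i. c (i + K)) < r / 4"
      using suminf_exist_split[of "r/4" c] r c by auto
    \<comment> \<open>Adding 1 keeps the divisor positive even if the initial segment sums to
      0.\<close>
    define S where "S = (\<Sum>i<K. c i) + 1"
    have S: "S > 0" unfolding S_def using sum_nonneg[of "{..<K}" c] c by simp
    obtain q where q: "q \<ge> 1" "\<And>i. i < K \<Longrightarrow> cmod (l i ^ q - 1) < r / (2 * S)"
      using unit_powers_simultaneously_near_one[of l "r / (2 * S)" K] l r S by auto
    have "D q = (\<Sum>i. c (i + K) * cmod (l (i + K) ^ q - 1)) + (\<Sum>i<K. c i * cmod (l i ^ q - 1))"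
      unfolding D_def by (rule suminf_split_initial_segment[OF sm])
    also have "(\<Sum>i. c (i + K) * cmod (l (i + K) ^ q - 1)) \<le> (\<Sum>i. c (i + K) * 2)"
      using c le2 summable_ignore_initial_segment[OF sm, of K q]
        summable_mult2[OF summable_ignore_initial_segment[OF c(1), of K], of 2]
      by (intro suminf_le) (auto intro!: mult_left_mono)
    also have "\<dots> = (\<Sum>i. c (i + K)) * 2"
      using summable_ignore_initial_segment[OF c(1), of K] by (rule suminf_mult2[symmetric])
    also have "\<dots> < r / 2" using K by simp
    also have "(\<Sum>i<K. c i * cmod (l i ^ q - 1)) \<le> (\<Sum>i<K. c i * (r / (2 * S)))"
      using c q by (intro sum_mono mult_left_mono) (auto intro: less_imp_le)
    also have "\<dots> = (\<Sum>i<K. c i) * (r / (2 * S))" by (simp only: sum_distrib_right)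
    also have "\<dots> \<le> S * (r / (2 * S))"
      using r S by (intro mult_right_mono) (auto simp: S_def)
    also have "\<dots> = r / 2" using S by simp
    finally have "D q < r" by simp
    then show ?thesis using q by auto
  qed
  \<comment> \<open>Multiples of a very good \<open>q\<close> are still good, which yields arbitrarily large \<open>n\<close>.\<close>
  obtain q where q: "q \<ge> 1" "D q < e / (n0 + 1)"
    using small[of "e / (n0 + 1)"] e by auto
  have "D (q * (n0 + 1)) \<le> (n0 + 1) * D q"
  proof -
    \<comment> \<open>In the unit disc, taking a \<open>k\<close>-th power expands distances by at
      most the factor \<open>k\<close>; the division by \<open>n0 + 1\<close> in the choice of
      \<open>q\<close> pays for this.\<close>
    have "cmod (l i ^ (q * k) - 1) \<le> k * cmod (l i ^ q - 1)" for i k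
    proof -
      have "cmod ((l i ^ q) ^ k - 1 ^ k) \<le> k * cmod (l i ^ q - 1)"
        by (rule norm_power_diff) (auto simp: norm_power l)
      then show ?thesis by (simp add: power_mult)
    qed
    then have "D (q * (n0 + 1)) \<le> (\<Sum>i. (n0 + 1) * (c i * cmod (l i ^ q - 1)))"
      unfolding D_def using c
      by (intro suminf_le sm summable_mult) (simp only: mult.left_commute[of _ "c _"] mult_left_mono)
    also have "\<dots> = (n0 + 1) * D q"
      unfolding D_def using sm by (rule suminf_mult)
    finally show ?thesis .
  qed
  also have "\<dots> < e" using q by (simp add: field_simps)
  finally have "D (q * (n0 + 1)) < e" .
  moreover have "n0 + 1 \<le> q * (n0 + 1)" using mult_le_mono1[OF q(1), of "n0 + 1"] by simp
  ultimately show thesis using that[of "q * (n0 + 1)"] unfolding D_def by linarith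
qed

section \<open>Cesaro means and uniqueness of coefficients of exponential sums\<close>

text \<open>The geometric sums stay below \<open>2 / cmod (1 - w)\<close> for all \<open>N\<close>,
  so dividing by \<open>N\<close> sends them to 0.\<close>

lemma cesaro_mean_unit_powers:
  fixes w :: complex
  assumes "cmod w = 1" and "w \<noteq> 1"
  shows "(\<lambda>N. (\<Sum>m<N. w ^ m) / N) \<longlonglongrightarrow> 0"
proof (rule Lim_null_comparison)
  show "\<forall>\<^sub>F N in sequentially. norm ((\<Sum>m<N. w ^ m) / N) \<le> (2 / cmod (1 - w)) * (1 / real N)"
  proof (rule always_eventually, rule allI)
    fix N
    have "cmod (1 - w ^ N) \<le> 2"
      using norm_triangle_ineq4[of 1 "w ^ N"] assms by (simp add: norm_power)
    then have "cmod (1 - w ^ N) / cmod (1 - w) / real N \<le> 2 / cmod (1 - w) / real N"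
      by (intro divide_right_mono) auto
    moreover have "(\<Sum>m<N. w ^ m) = (1 - w ^ N) / (1 - w)"
      using assms(2) by (simp add: sum_gp_strict)
    ultimately show "norm ((\<Sum>m<N. w ^ m) / N) \<le> (2 / cmod (1 - w)) * (1 / real N)"
      by (simp add: norm_divide norm_mult)
  qed
  show "(\<lambda>N. 2 / cmod (1 - w) * (1 / real N)) \<longlonglongrightarrow> 0"
    by (intro tendsto_mult_right_zero lim_1_over_n)
qed

text \<open>Dividing by \<open>l j ^ m\<close> and averaging over \<open>m\<close> isolates the
  \<open>j\<close>-th coefficient: all other terms have a ratio \<open>w i \<noteq> 1\<close> and
  average out. Tannery's theorem, with dominating series \<open>cmod (a i)\<close>, exchanges the
  limit in \<open>N\<close> with the sum over \<open>i\<close>.\<close>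

lemma exponential_sum_coeff_zero:
  fixes a l :: "nat \<Rightarrow> complex"
  assumes l: "\<And>i. cmod (l i) = 1" "inj l" and a: "summable (\<lambda>i. cmod (a i))"
    and zero: "\<And>m. (\<Sum>i. a i * l i ^ m) = 0"
  shows "a j = 0"
proof -
  define w where "w i = l i / l j" for i
  have lj: "l j \<noteq> 0" using l(1)[of j] by auto
  have w: "cmod (w i) = 1" "w i = 1 \<longleftrightarrow> i = j" for i
    using l lj by (auto simp: w_def norm_divide inj_eq)
  have sm: "summable (\<lambda>i. a i * w i ^ m)" for m
    by (rule summable_comparison_test'[OF a, of 0]) (auto simp: norm_mult norm_power w)
  have "(\<Sum>i. a i * w i ^ m) = 0" for m
  proof -
    have "summable (\<lambda>i. a i * l i ^ m)"
      by (rule summable_comparison_test'[OF a, of 0]) (auto simp: norm_mult norm_power l)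
    then have "(\<Sum>i. a i * l i ^ m / l j ^ m) = 0"
      using zero[of m] by (simp add: suminf_divide)
    then show ?thesis by (simp add: w_def power_divide)
  qed
  define A where "A i N = a i * ((\<Sum>m<N. w i ^ m) / of_nat N)" for i N
  have A0: "(\<Sum>i. A i N) = 0" for N
  proof -
    have "(\<Sum>i. \<Sum>m<N. a i * w i ^ m) = (\<Sum>m<N. \<Sum>i. a i * w i ^ m)"
      by (rule suminf_sum[OF sm])
    then have "(\<Sum>i. \<Sum>m<N. a i * w i ^ m) = 0"
      by (simp add: \<open>\<And>m. (\<Sum>i. a i * w i ^ m) = 0\<close>)
    then have "(\<Sum>i. (\<Sum>m<N. a i * w i ^ m) / of_nat N) = 0"
      using suminf_divide[of "\<lambda>i. \<Sum>m<N. a i * w i ^ m" "of_nat N"] sm by (simp add: summable_sum)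
    then show ?thesis by (simp add: A_def sum_distrib_left)
  qed
  have "(\<lambda>N. \<Sum>i. A i N) \<longlonglongrightarrow> (\<Sum>i. if i = j then a i else 0)"
  proof (rule tannerys_theorem[THEN conjunct2, THEN conjunct2])
    show "(\<lambda>N. A i N) \<longlonglongrightarrow> (if i = j then a i else 0)" for i
    proof (cases "i = j")
      case True
      have "\<forall>\<^sub>F N in sequentially. A i N = a i"
        using eventually_gt_at_top[of 0] by eventually_elim (use True w(2)[of j] in \<open>simp add: A_def\<close>)
      then show ?thesis using True by (simp add: tendsto_eventually)
    next
      case False
      then show ?thesis
        unfolding A_def using tendsto_mult_right_zero[OF cesaro_mean_unit_powers[of "w i"]] w
        by simp
    qed
    have "norm (A i N) \<le> cmod (a i)" for i N
    proof -
      have "cmod (\<Sum>m<N. w i ^ m) \<le> (\<Sum>m<N. 1)"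
        by (rule sum_norm_le) (simp add: norm_power w)
      then have "cmod ((\<Sum>m<N. w i ^ m) / of_nat N) \<le> 1"
        by (cases "N = 0") (auto simp: norm_divide field_simps)
      then show ?thesis
        unfolding A_def norm_mult by (intro mult_left_le) auto
    qed
    then show "\<forall>\<^sub>F (i, N) in sequentially \<times>\<^sub>F sequentially. norm (A i N) \<le> cmod (a i)"
      by (auto intro: always_eventually)
    show "summable (\<lambda>i. cmod (a i))" by (rule a)
  qed simp
  then have "(\<lambda>N. 0) \<longlonglongrightarrow> a j"
    unfolding A0 using suminf_finite[of "{j}" "\<lambda>i. if i = j then a i else 0"] by simp
  then show ?thesis by (simp add: LIMSEQ_const_iff)
qed

section \<open>A function that almost returns at infinitely many times\<close>

text \<open>What matters later is that \<open>\<eta> n\<close> does not depend on the point, so that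
  whole shells of \<open>u\<close> return together, and that \<open>u\<close> takes arbitrarily
  small positive values on sets that are not null.\<close>

lemma almost_recurrent_function:
  fixes T :: "'a \<Rightarrow> 'a"
  assumes ns: "nonsingular M T" and pos: "emeasure M (space M) > 0"
    and inf: "infinite {l. eigenvalue M T l}"
  obtains u :: "'a \<Rightarrow> real" and \<eta> :: "nat \<Rightarrow> real"
  where "u \<in> borel_measurable M" "\<And>x. u x \<ge> 0"
    "AE x in M. \<forall>n. \<bar>u ((T ^^ n) x) - u x\<bar> \<le> \<eta> n"
    "\<And>e n0. e > 0 \<Longrightarrow> \<exists>n\<ge>n0. \<eta> n < e"
    "\<And>r. r > 0 \<Longrightarrow> \<not> (AE x in M. \<not> (0 < u x \<and> u x < r))"
proof -
  obtain l :: "nat \<Rightarrow> complex" where l: "inj l" "range l \<subseteq> {l. eigenvalue M T l}"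
    using infinite_countable_subset[OF inf] by blast
  have ev: "eigenvalue M T (l i)" for i using l(2) by auto
  have l1: "cmod (l i) = 1" for i
    by (rule eigenvalue_norm[OF ns pos ev])
  \<comment> \<open>Bundling the four properties lets a single choice yield all \<open>f i\<close>
    and \<open>C i\<close>.\<close>
  define Q where "Q i f C \<longleftrightarrow> (AE x in M. f x \<noteq> 0) \<and> f \<in> borel_measurable M \<and>
    (AE x in M. cmod (f x) \<le> C) \<and> (AE x in M. f (T x) = l i * f x)" for i f C
  have "\<exists>f C. Q i f C" for i
    using ev[of i] unfolding eigenvalue_def Q_def by blast
  then obtain f C where "\<And>i. Q i (f i) (C i)"
    by metis
  then have f: "\<And>i. AE x in M. f i x \<noteq> 0" "\<And>i. f i \<in> borel_measurable M"
    "\<And>i. AE x in M. cmod (f i x) \<le> C i" "\<And>i. AE x in M. f i (T x) = l i * f i x"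
    by (auto simp: Q_def)
  \<comment> \<open>These weights make the series for \<open>h\<close> dominated by a geometric one;
    \<open>max 1\<close> protects against a bound \<open>C i\<close> that is not positive.\<close>
  define c where "c i = (1/2) ^ i / max 1 (C i)" for i
  have c0: "c i > 0" for i by (simp add: c_def)
  define h where "h x = (\<Sum>i. c i * f i x)" for x
  define \<eta> where "\<eta> n = (\<Sum>i. (1/2) ^ i * cmod (l i ^ n - 1))" for n
  have half: "summable (\<lambda>i. (1/2 :: real) ^ i)" by (simp add: summable_geometric)
  have \<eta>: "\<exists>n\<ge>n0. n \<ge> 1 \<and> \<eta> n < e" if "e > 0" for e n0
    by (rule unit_weighted_recurrence[of l "\<lambda>i. (1/2) ^ i" e n0])
      (use l1 half that in \<open>auto simp: \<eta>_def\<close>)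
  \<comment> \<open>\<open>G\<close> collects countably many almost sure conditions, including the
    eigenvalue equations along the whole orbit, so that the estimates below become
    pointwise.\<close>
  define G where "G x \<longleftrightarrow> (\<forall>i m. f i x \<noteq> 0 \<and> cmod (f i x) \<le> C i \<and> f i ((T ^^ m) x) = l i ^ m * f i x)" for x
  have AEG: "AE x in M. G x"
  proof -
    have "AE x in M. \<forall>i n. f i (T ((T ^^ n) x)) = l i * f i ((T ^^ n) x)"
      unfolding AE_all_countable
      by (intro allI nonsingular_AE_funpow[OF ns, where P = "\<lambda>x. f i (T x) = l i * f i x" for i] f)
    moreover have "AE x in M. \<forall>i. f i x \<noteq> 0 \<and> cmod (f i x) \<le> C i"
      using f by (simp add: AE_all_countable)
    ultimately show ?thesis
    proof eventually_elim
      case (elim x)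
      have "f i ((T ^^ m) x) = l i ^ m * f i x" for i m
        using elim(1) by (induction m) auto
      then show ?case using elim(2) unfolding G_def by auto
    qed
  qed
  have cf: "c i * cmod (f i x) \<le> (1/2) ^ i" if "G x" for i x
  proof -
    have "cmod (f i x) \<le> max 1 (C i)" using that unfolding G_def by (metis max.coboundedI2)
    then show ?thesis unfolding c_def by (simp add: field_simps)
  qed
  have sm: "summable (\<lambda>i. c i * f i x * l i ^ m)" if "G x" for x m
    by (rule summable_comparison_test'[OF half, of 0])
      (use cf[OF that] c0 l1 in \<open>simp add: norm_mult norm_power less_imp_le\<close>)
  have hm: "h ((T ^^ m) x) = (\<Sum>i. c i * f i x * l i ^ m)" if "G x" for x m
    using that unfolding h_def G_def by (simp add: mult_ac)
  \<comment> \<open>The extra shift \<open>m\<close> turns the difference into an exponential sum in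
    \<open>m\<close>, the form required by \<open>exponential_sum_coeff_zero\<close>.\<close>
  have hdiff: "h ((T ^^ (n + m)) x) - h ((T ^^ m) x) = (\<Sum>i. c i * f i x * (l i ^ n - 1) * l i ^ m)"
    if "G x" for x n m
    unfolding hm[OF that] suminf_diff[OF sm[OF that] sm[OF that]]
    by (simp add: algebra_simps power_add)
  have hn: "cmod (h ((T ^^ n) x) - h x) \<le> \<eta> n" if "G x" for x n
  proof -
    have "cmod (\<Sum>i. c i * f i x * (l i ^ n - 1)) \<le> (\<Sum>i. (1/2) ^ i * cmod (l i ^ n - 1))"
    proof (rule norm_suminf_le)
      show "cmod (c i * f i x * (l i ^ n - 1)) \<le> (1/2) ^ i * cmod (l i ^ n - 1)" for i
        using mult_right_mono[OF cf[OF that, of i], of "cmod (l i ^ n - 1)"] c0[of i]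
        by (simp add: norm_mult)
      have "cmod (l i ^ n - 1) \<le> 2" for i
        using norm_triangle_ineq4[of "l i ^ n" 1] l1 by (simp add: norm_power)
      then show "summable (\<lambda>i. (1/2) ^ i * cmod (l i ^ n - 1))"
        by (intro summable_comparison_test'[OF summable_mult2[OF half, of 2], of 0])
          (auto intro!: mult_left_mono simp: norm_mult)
    qed
    then show ?thesis using hdiff[OF that, of n 0] by (simp add: \<eta>_def)
  qed
  have hbd: "h x \<in> cball 0 2" if "G x" for x
  proof -
    have "cmod (\<Sum>i. c i * f i x) \<le> (\<Sum>i. (1/2) ^ i)"
      using cf[OF that] c0 half by (intro norm_suminf_le) (auto simp: norm_mult less_imp_le)
    then show ?thesis by (simp add: h_def suminf_geometric)
  qed
  have hmeas: "h \<in> borel_measurable M"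
    unfolding h_def using f(2) by measurable
  \<comment> \<open>Otherwise each \<open>z\<close> has a punctured disc that \<open>h\<close>
    avoids almost surely. By compactness finitely many of these discs, with their centres, cover the
    essential range, so \<open>h\<close> almost surely takes values in the finite set
    \<open>F\<close> of centres.\<close>
  have "\<exists>z. \<forall>r>0. \<not> (AE x in M. \<not> (0 < dist (h x) z \<and> dist (h x) z < r))"
  proof (rule ccontr)
    assume "\<not> ?thesis"
    then obtain r where r: "\<And>z. r z > 0"
      "\<And>z. AE x in M. \<not> (0 < dist (h x) z \<and> dist (h x) z < r z)"
      by metis
    have "compact (cball (0 :: complex) 2)" by simp
    moreover have "cball (0 :: complex) 2 \<subseteq> (\<Union>z\<in>UNIV. ball z (r z))"
      by (meson UNIV_I UN_I centre_in_ball r(1) subsetI)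
    ultimately obtain F where F: "finite F" "cball (0 :: complex) 2 \<subseteq> (\<Union>z\<in>F. ball z (r z))"
      using compactE_image[of "cball (0 :: complex) 2" UNIV "\<lambda>z. ball z (r z)"]
      by (metis open_ball subset_UNIV)
    have "AE x in M. \<forall>z\<in>F. \<not> (0 < dist (h x) z \<and> dist (h x) z < r z)"
      using F(1) r(2) by (simp add: AE_finite_all)
    with AEG have "AE x in M. h x \<in> F"
    proof eventually_elim
      case (elim x)
      obtain z where "z \<in> F" "h x \<in> ball z (r z)" using hbd[OF elim(1)] F(2) by blast
      then show ?case using elim(2) by (auto simp: dist_commute)
    qed
    then have AEF: "AE x in M. \<forall>m. h ((T ^^ m) x) \<in> F"
      unfolding AE_all_countable by (intro allI nonsingular_AE_funpow[OF ns])
    obtain g where g: "g > 0" "\<And>a b. a \<in> F \<Longrightarrow> b \<in> F \<Longrightarrow> dist a b < g \<Longrightarrow> a = b"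
      using uniform_discrete_finite_iff F(1) unfolding uniform_discrete_def by metis
    \<comment> \<open>\<open>T ^^ n\<close> moves \<open>h\<close> by less than the gap
      \<open>g\<close> between distinct points of \<open>F\<close>, hence not at all along almost
      every orbit.\<close>
    obtain n where n: "n \<ge> 1" "\<eta> n < g"
      using \<eta>[OF g(1)] by blast
    have "AE x in M. \<forall>m. G ((T ^^ m) x)"
      unfolding AE_all_countable by (intro allI nonsingular_AE_funpow[OF ns AEG])
    with AEF have "AE x in M. False"
    proof eventually_elim
      case (elim x)
      have Gx: "G x" using elim(2) by (metis funpow_0)
      have "h ((T ^^ (n + m)) x) = h ((T ^^ m) x)" for m
      proof (rule g(2))
        have "cmod (h ((T ^^ n) ((T ^^ m) x)) - h ((T ^^ m) x)) \<le> \<eta> n"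
          using elim(2) hn by blast
        then show "dist (h ((T ^^ (n + m)) x)) (h ((T ^^ m) x)) < g"
          using n(2) by (simp add: dist_norm funpow_add)
      qed (use elim in auto)
      then have zero: "(\<Sum>i. c i * f i x * (l i ^ n - 1) * l i ^ m) = 0" for m
        using hdiff[OF Gx, of n m] by simp
      have "summable (\<lambda>i. cmod (c i * f i x * (l i ^ n - 1)))"
      proof (rule summable_comparison_test'[OF summable_mult2[OF half, of 2], of 0])
        fix i
        have "cmod (l i ^ n - 1) \<le> 2"
          using norm_triangle_ineq4[of "l i ^ n" 1] l1 by (simp add: norm_power)
        then show "norm (cmod (c i * f i x * (l i ^ n - 1))) \<le> (1/2) ^ i * 2"
          using cf[OF Gx, of i] c0[of i] by (auto simp: norm_mult intro!: mult_mono)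
      qed
      then have "c i * f i x * (l i ^ n - 1) = 0" for i
        using exponential_sum_coeff_zero[of l "\<lambda>i. c i * f i x * (l i ^ n - 1)" i] l1 l(1) zero
        by blast
      \<comment> \<open>The factors \<open>c i\<close> and \<open>f i x\<close> do not vanish at a
        good point. So all \<open>l i\<close> would be \<open>n\<close>-th roots of unity, of which
        there are finitely many because \<open>n \<ge> 1\<close>.\<close>
      then have "l i ^ n = 1" for i
        using Gx c0[of i] unfolding G_def by (metis eq_iff_diff_eq_0 less_irrefl mult_eq_0_iff of_real_eq_0_iff)
      then have "range l \<subseteq> {z. z ^ n = 1}" by auto
      then have "finite (range l)"
        by (rule finite_subset[OF _ finite_roots_unity[OF n(1)]])
      then show ?case using l(1) finite_imageD by blast
    qed
    then show False using pos AE_iff_null[of M "\<lambda>_. False"] by auto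
  qed
  then obtain z where z: "\<And>r. r > 0 \<Longrightarrow> \<not> (AE x in M. \<not> (0 < dist (h x) z \<and> dist (h x) z < r))"
    by blast
  show thesis
  proof (rule that[of "\<lambda>x. dist (h x) z" \<eta>])
    show "(\<lambda>x. dist (h x) z) \<in> borel_measurable M"
      using hmeas by measurable
    show "AE x in M. \<forall>n. \<bar>dist (h ((T ^^ n) x)) z - dist (h x) z\<bar> \<le> \<eta> n"
      using AEG
    proof eventually_elim
      case (elim x)
      show ?case
      proof
        fix n
        have "dist (h ((T ^^ n) x)) (h x) \<le> \<eta> n" using hn[OF elim] by (simp add: dist_norm)
        then show "\<bar>dist (h ((T ^^ n) x)) z - dist (h x) z\<bar> \<le> \<eta> n"
          using abs_dist_diff_le[of "h ((T ^^ n) x)" z "h x"] by (simp add: dist_commute)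
      qed
    qed
    show "\<exists>n\<ge>n0. \<eta> n < e" if "e > 0" for e n0
      using \<eta>[OF that] by blast
    show "\<not> (AE x in M. \<not> (0 < dist (h x) z \<and> dist (h x) z < r))" if "r > 0" for r
      by (rule z[OF that])
  qed simp
qed

subsection \<open>Good metrics from piecewise charts\<close>

lemma pullback_Metric_space:
  fixes \<psi> :: "'a \<Rightarrow> real"
  assumes "inj_on \<psi> Z"
  shows "Metric_space Z (\<lambda>x y. \<bar>\<psi> x - \<psi> y\<bar>)"
  using assms by unfold_locales (auto simp: inj_on_def)

lemma openin_pullback_metric_iff:
  fixes \<psi> :: "'a \<Rightarrow> real"
  assumes "inj_on \<psi> Z"
  shows "openin (Metric_space.mtopology Z (\<lambda>x y. \<bar>\<psi> x - \<psi> y\<bar>)) U \<longleftrightarrow> (\<exists>W. open W \<and> U = Z \<inter> \<psi> -` W)"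
proof -
  interpret Metric_space Z "\<lambda>x y. \<bar>\<psi> x - \<psi> y\<bar>"
    using assms by (rule pullback_Metric_space)
  show ?thesis
  proof
    assume "openin mtopology U"
    then have U: "U \<subseteq> Z" "\<forall>x\<in>U. \<exists>r>0. mball x r \<subseteq> U"
      by (auto simp: openin_mtopology)
    then obtain r where r: "\<And>x. x \<in> U \<Longrightarrow> r x > 0" "\<And>x. x \<in> U \<Longrightarrow> mball x (r x) \<subseteq> U"
      by metis
    have "U = Z \<inter> \<psi> -` (\<Union>x\<in>U. ball (\<psi> x) (r x))"
    proof
      show "U \<subseteq> Z \<inter> \<psi> -` (\<Union>x\<in>U. ball (\<psi> x) (r x))"
      proof
        fix x assume x: "x \<in> U"
        then have "\<psi> x \<in> ball (\<psi> x) (r x)" using r(1) by (simp only: centre_in_ball)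
        with x U(1) show "x \<in> Z \<inter> \<psi> -` (\<Union>x\<in>U. ball (\<psi> x) (r x))" by blast
      qed
      show "Z \<inter> \<psi> -` (\<Union>x\<in>U. ball (\<psi> x) (r x)) \<subseteq> U"
      proof
        fix y assume "y \<in> Z \<inter> \<psi> -` (\<Union>x\<in>U. ball (\<psi> x) (r x))"
        then obtain x where "x \<in> U" "y \<in> mball x (r x)"
          using U(1) by (auto simp: dist_real_def)
        then show "y \<in> U" using r(2) by blast
      qed
    qed
    then show "\<exists>W. open W \<and> U = Z \<inter> \<psi> -` W"
      by (intro exI[of _ "\<Union>x\<in>U. ball (\<psi> x) (r x)"]) auto
  next
    assume "\<exists>W. open W \<and> U = Z \<inter> \<psi> -` W"
    then obtain W where W: "open W" "U = Z \<inter> \<psi> -` W" by blast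
    have "\<exists>r>0. mball x r \<subseteq> U" if "x \<in> U" for x
    proof -
      have "\<psi> x \<in> W" using W(2) that by blast
      with W(1) obtain r where "r > 0" "ball (\<psi> x) r \<subseteq> W" by (rule openE)
      then show ?thesis
        using W(2) by (intro exI[of _ r]) (auto simp: subset_iff dist_real_def)
    qed
    then show "openin mtopology U"
      using W(2) by (auto simp: openin_mtopology)
  qed
qed

text \<open>Members of an open cover of \<open>C\<close> are pulled back from open sets of the line,
  so a finite subcover of the image of \<open>C\<close> lifts to one of \<open>C\<close>.\<close>

lemma compactin_pullback_metric:
  fixes \<psi> :: "'a \<Rightarrow> real"
  assumes inj: "inj_on \<psi> Z" and "C \<subseteq> Z" and "compact (\<psi> ` C)"
  shows "compactin (Metric_space.mtopology Z (\<lambda>x y. \<bar>\<psi> x - \<psi> y\<bar>)) C"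
proof -
  interpret Metric_space Z "\<lambda>x y. \<bar>\<psi> x - \<psi> y\<bar>"
    using inj by (rule pullback_Metric_space)
  have "\<exists>\<F>. finite \<F> \<and> \<F> \<subseteq> \<U> \<and> C \<subseteq> \<Union>\<F>"
    if \<U>: "\<And>U. U \<in> \<U> \<Longrightarrow> openin mtopology U" "C \<subseteq> \<Union>\<U>" for \<U>
  proof -
    obtain W where W: "\<And>U. U \<in> \<U> \<Longrightarrow> open (W U) \<and> U = Z \<inter> \<psi> -` W U"
      using \<U>(1) unfolding openin_pullback_metric_iff[OF inj] by metis
    have "\<psi> ` C \<subseteq> (\<Union>U\<in>\<U>. W U)"
      using \<U>(2) W by blast
    then obtain \<F> where \<F>: "\<F> \<subseteq> \<U>" "finite \<F>" "\<psi> ` C \<subseteq> (\<Union>U\<in>\<F>. W U)"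
      using compactE_image[OF assms(3), of \<U> W] W by blast
    have "C \<subseteq> \<Union>\<F>"
    proof
      fix x assume "x \<in> C"
      then obtain U where "U \<in> \<F>" "\<psi> x \<in> W U" using \<F>(3) by blast
      then show "x \<in> \<Union>\<F>" using W[of U] \<F>(1) \<open>x \<in> C\<close> assms(2) by blast
    qed
    then show ?thesis using \<F> by blast
  qed
  then show ?thesis
    using assms(2) unfolding compactin_def by simp
qed

section \<open>Measure-preserving charts into the line\<close>

text \<open>This identifies the space with a Lebesgue measurable subset of the line. Speaking of
  images instead of an inverse map makes the property pass to measurable subsets at once.\<close>

definition lebesgue_chart :: "'a measure \<Rightarrow> ('a \<Rightarrow> real) \<Rightarrow> bool" where
  "lebesgue_chart N \<phi> \<longleftrightarrow> inj_on \<phi> (space N) \<and>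
     (\<forall>A\<in>sets N. \<phi> ` A \<in> sets lebesgue \<and> emeasure N A = emeasure lebesgue (\<phi> ` A)) \<and>
     \<phi> \<in> measurable N lebesgue"

lemma lebesgue_chart_restrict:
  assumes "lebesgue_chart N \<phi>" and Z: "Z \<in> sets N"
  shows "lebesgue_chart (restrict_space N Z) \<phi>"
proof -
  have Z': "Z \<inter> space N = Z" using sets.sets_into_space[OF Z] by blast
  have "\<phi> \<in> measurable (restrict_space N Z) lebesgue"
    using assms(1) by (auto simp: lebesgue_chart_def intro: measurable_restrict_space1)
  moreover have "inj_on \<phi> Z"
    using assms(1) Z' unfolding lebesgue_chart_def by (metis inf_le2 inj_on_subset)
  ultimately show ?thesis
    using assms unfolding lebesgue_chart_def
    by (auto simp: sets_restrict_space_iff space_restrict_space emeasure_restrict_space Z')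
qed

lemma restrict_space_whole: "restrict_space M (space M) = M"
  by (rule measure_eqI)
    (use sets.sets_into_space[of _ M] in \<open>auto simp: sets_restrict_space_iff emeasure_restrict_space\<close>)

text \<open>A singleton of positive measure cannot be split into two parts of positive measure, so
  there are no atoms and only the isomorphism with an interval remains.\<close>

lemma nonatomic_lebesgue_space_chart:
  assumes "lebesgue_space M" and "nonatomic M"
  obtains X \<phi> where "X \<in> sets M" "space M - X \<in> null_sets M" "lebesgue_chart (restrict_space M X) \<phi>"
proof -
  obtain D I X Y \<phi> where D: "\<forall>c\<in>D. {c} \<in> sets M \<and> emeasure M {c} > 0" and I: "is_interval (I :: real set)"
    and iso: "iso_mod_null (restrict_space M (space M - D)) (lebesgue_on I) X Y \<phi>"
    using assms(1) unfolding lebesgue_space_def by blast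
  have "D = {}"
  proof (rule ccontr)
    assume "D \<noteq> {}"
    then obtain c where c: "{c} \<in> sets M" "emeasure M {c} > 0" using D by blast
    then obtain B where B: "B \<subseteq> {c}" "emeasure M B > 0" "emeasure M ({c} - B) > 0"
      using assms(2) unfolding nonatomic_def by metis
    then have "B = {} \<or> B = {c}" by blast
    then show False using B(2,3) by (metis Diff_cancel emeasure_empty less_irrefl)
  qed
  then have iso: "iso_mod_null M (lebesgue_on I) X Y \<phi>"
    using iso by (simp add: restrict_space_whole)
  have "I \<in> sets lebesgue"
    using I by (simp add: real_interval_borel_measurable)
  then have Y: "Y \<subseteq> I" "Y \<in> sets lebesgue"
    using iso by (auto simp: iso_mod_null_def sets_restrict_space_iff)
  have LY: "restrict_space (lebesgue_on I) Y = lebesgue_on Y"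
    using Y \<open>I \<in> sets lebesgue\<close> by (simp add: restrict_restrict_space Int_absorb1)
  have X: "X \<in> sets M" "space M - X \<in> null_sets M" and bij: "bij_betw \<phi> X Y"
    and meas: "\<phi> \<in> measurable (restrict_space M X) (lebesgue_on Y)"
    and inv: "the_inv_into X \<phi> \<in> measurable (lebesgue_on Y) (restrict_space M X)"
    and distr: "distr (restrict_space M X) (lebesgue_on Y) \<phi> = lebesgue_on Y"
    using iso unfolding iso_mod_null_def LY by auto
  have inj: "inj_on \<phi> X" and im: "\<phi> ` X = Y"
    using bij by (auto simp: bij_betw_def)
  have sp: "space (restrict_space M X) = X" using X(1) by simp
  have "\<phi> ` A \<in> sets lebesgue \<and> emeasure (restrict_space M X) A = emeasure lebesgue (\<phi> ` A)"
    if A: "A \<in> sets (restrict_space M X)" for A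
  proof -
    have AX: "A \<subseteq> X" using sets.sets_into_space[OF A] sp by simp
    have "the_inv_into X \<phi> -` A \<inter> Y = \<phi> ` A"
      using AX inj im by (auto simp: the_inv_into_f_f subset_iff image_iff)
    then have "\<phi> ` A \<in> sets (lebesgue_on Y)"
      using measurable_sets[OF inv A] by simp
    moreover have "\<phi> -` (\<phi> ` A) \<inter> X = A"
      using AX inj by (auto simp: inj_on_def)
    ultimately have "emeasure (lebesgue_on Y) (\<phi> ` A) = emeasure (restrict_space M X) A"
      using emeasure_distr[OF meas, of "\<phi> ` A"] by (simp add: distr sp)
    then show ?thesis
      using \<open>\<phi> ` A \<in> sets (lebesgue_on Y)\<close> Y(2) AX im
      by (auto simp: sets_restrict_space_iff emeasure_restrict_space image_mono)
  qed
  moreover have "\<phi> \<in> measurable (restrict_space M X) lebesgue"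
    using meas Y(2) by (simp add: measurable_restrict_space2_iff)
  ultimately have "lebesgue_chart (restrict_space M X) \<phi>"
    unfolding lebesgue_chart_def using inj sp by auto
  then show thesis using that X by blast
qed

section \<open>Regularity of the metric of a piecewise chart\<close>

lemma measurable_piecewise_chart:
  assumes "\<And>i. continuous_on UNIV (g i :: real \<Rightarrow> real)" and "\<phi> \<in> measurable N lebesgue"
    and "(p :: 'a \<Rightarrow> nat) \<in> measurable N (count_space UNIV)"
  shows "(\<lambda>x. g (p x) (\<phi> x)) \<in> borel_measurable N"
proof (rule measurable_compose_countable[OF _ assms(3)])
  fix i
  have "\<phi> \<in> borel_measurable N"
    using assms(2) by (rule measurable_compose) (simp add: measurable_completion)
  then show "(\<lambda>x. g i (\<phi> x)) \<in> borel_measurable N"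
    using assms(1) by (rule borel_measurable_continuous_on[rotated])
qed

text \<open>On the piece \<open>p x = i\<close> the metric is that of the line transported by
  \<open>g i\<close>, which is an open map, and the ranges for different \<open>i\<close> are
  disjoint. So the open and compact approximations of Lebesgue sets carry over piece by
  piece.\<close>

lemma regular_wrt_piecewise_chart:
  fixes g :: "nat \<Rightarrow> real \<Rightarrow> real" and p :: "'a \<Rightarrow> nat"
  assumes chart: "lebesgue_chart N \<phi>" and p: "p \<in> measurable N (count_space UNIV)"
    and cont: "\<And>i. continuous_on UNIV (g i)"
    and g: "\<And>i j s t. g i s = g j t \<Longrightarrow> i = j \<and> s = t"
  defines "\<psi> \<equiv> \<lambda>x. g (p x) (\<phi> x)"
  shows "regular_wrt N (\<lambda>x y. \<bar>\<psi> x - \<psi> y\<bar>)"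
proof -
  let ?\<tau> = "Metric_space.mtopology (space N) (\<lambda>x y. \<bar>\<psi> x - \<psi> y\<bar>)"
  have inj: "inj_on \<phi> (space N)" and \<phi>: "\<phi> \<in> measurable N lebesgue"
    and im: "\<And>A. A \<in> sets N \<Longrightarrow> \<phi> ` A \<in> sets lebesgue"
    and em: "\<And>A. A \<in> sets N \<Longrightarrow> emeasure N A = emeasure lebesgue (\<phi> ` A)"
    using chart unfolding lebesgue_chart_def by auto
  have inj\<psi>: "inj_on \<psi> (space N)"
    using inj g unfolding \<psi>_def inj_on_def by metis
  have \<psi>: "\<psi> \<in> borel_measurable N"
    unfolding \<psi>_def using cont \<phi> p by (rule measurable_piecewise_chart)
  have op: "open (g i ` U)" if "open U" for i U
    using injective_eq_1d_open_map_UNIV[OF cont[of i]] g that by (auto simp: inj_on_def)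
  have opsets: "U \<in> sets N" if "openin ?\<tau> U" for U
    using that measurable_sets[OF \<psi>] unfolding openin_pullback_metric_iff[OF inj\<psi>]
    by (auto simp: Int_commute)
  have piece: "A \<inter> p -` {i} \<in> sets N" if "A \<in> sets N" for A i
  proof -
    have "A \<inter> p -` {i} = A \<inter> (p -` {i} \<inter> space N)"
      using sets.sets_into_space[OF that] by blast
    then show ?thesis using that p by auto
  qed
  have outer: "emeasure N A = (INF U\<in>{U. openin ?\<tau> U \<and> A \<subseteq> U}. emeasure N U)" if A: "A \<in> sets N" for A
  proof (rule antisym)
    show "emeasure N A \<le> (INF U\<in>{U. openin ?\<tau> U \<and> A \<subseteq> U}. emeasure N U)"
      by (rule INF_greatest) (auto intro: emeasure_mono opsets)
    show "(INF U\<in>{U. openin ?\<tau> U \<and> A \<subseteq> U}. emeasure N U) \<le> emeasure N A"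
    proof (rule ennreal_le_epsilon)
      fix e :: real assume e: "e > 0"
      let ?A = "\<lambda>i. A \<inter> p -` {i}"
      \<comment> \<open>The excess is the measure of a difference set, since \<open>A\<close> may
        have infinite measure; the allowances add up to \<open>e\<close>.\<close>
      have "\<exists>U. open U \<and> \<phi> ` ?A i \<subseteq> U \<and> U - \<phi> ` ?A i \<in> sets lebesgue \<and>
          emeasure lebesgue (U - \<phi> ` ?A i) < ennreal (e * (1/2) ^ Suc i)" for i
        using sets_lebesgue_outer_open[OF im[OF piece[OF A]], of "e * (1/2) ^ Suc i"] e
        by (metis fmeasurableD half_gt_zero_iff mult_pos_pos zero_less_one zero_less_power)
      then obtain U where U: "\<And>i. open (U i)" "\<And>i. \<phi> ` ?A i \<subseteq> U i"
        "\<And>i. U i - \<phi> ` ?A i \<in> sets lebesgue"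
        "\<And>i. emeasure lebesgue (U i - \<phi> ` ?A i) < ennreal (e * (1/2) ^ Suc i)"
        by metis
      define V where "V = space N \<inter> \<psi> -` (\<Union>i. g i ` U i)"
      have V: "openin ?\<tau> V"
        unfolding openin_pullback_metric_iff[OF inj\<psi>] V_def
        by (intro exI[of _ "\<Union>i. g i ` U i"] conjI refl open_UN ballI op U(1))
      \<comment> \<open>Disjointness of the ranges ensures that \<open>g i\<close> applied to
        \<open>U i\<close> adds no points of other pieces.\<close>
      have V_iff: "x \<in> V \<longleftrightarrow> x \<in> space N \<and> \<phi> x \<in> U (p x)" for x
    proof
      assume "x \<in> V"
      then obtain i t where "x \<in> space N" "t \<in> U i" "g (p x) (\<phi> x) = g i t"
        unfolding V_def \<psi>_def by blast
      then show "x \<in> space N \<and> \<phi> x \<in> U (p x)" using g by metis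
    qed (auto simp: V_def \<psi>_def)
      have AV: "A \<subseteq> V"
      proof
        fix x assume "x \<in> A"
        then show "x \<in> V"
          using sets.sets_into_space[OF A] U(2)[of "p x"] by (auto simp: V_iff)
      qed
      have VA: "V - A \<in> sets N" using opsets[OF V] A by blast
      have "emeasure N (V - A) = emeasure N (\<Union>i. (V - A) \<inter> p -` {i})"
        by (rule arg_cong[where f = "emeasure N"]) auto
      also have "\<dots> \<le> (\<Sum>i. emeasure N ((V - A) \<inter> p -` {i}))"
        by (rule emeasure_subadditive_countably) (simp add: image_subset_iff piece[OF VA])
      also have "\<dots> \<le> (\<Sum>i. ennreal (e * (1/2) ^ Suc i))"
      proof (intro suminf_le summableI)
        fix i
        have "\<phi> ` ((V - A) \<inter> p -` {i}) \<subseteq> U i - \<phi> ` ?A i"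
        proof
          fix t assume "t \<in> \<phi> ` ((V - A) \<inter> p -` {i})"
          then obtain x where x: "x \<in> space N" "x \<notin> A" "t = \<phi> x" "t \<in> U i"
            by (auto simp: V_iff)
          then have "t \<notin> \<phi> ` ?A i"
            using inj_onD[OF inj, of x] sets.sets_into_space[OF A] by auto
          with x show "t \<in> U i - \<phi> ` ?A i" by blast
        qed
        then have "emeasure N ((V - A) \<inter> p -` {i}) \<le> emeasure lebesgue (U i - \<phi> ` ?A i)"
          using em[OF piece[OF VA]] emeasure_mono U(3) by metis
        then show "emeasure N ((V - A) \<inter> p -` {i}) \<le> ennreal (e * (1/2) ^ Suc i)"
          using U(4)[of i] by (rule order.trans[OF _ less_imp_le])
      qed
      also have "\<dots> = ennreal e"
        using e sums_mult[OF power_half_series, of e] by (intro suminf_ennreal_eq) auto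
      finally have "emeasure N V \<le> emeasure N A + ennreal e"
        using emeasure_subadditive[OF A VA] AV
        by (metis Diff_partition add_left_mono order.trans)
      then show "(INF U\<in>{U. openin ?\<tau> U \<and> A \<subseteq> U}. emeasure N U) \<le> emeasure N A + ennreal e"
        using V AV by (intro INF_lower2[of V]) auto
    qed
  qed
  have inner: "emeasure N A = (SUP K\<in>{K. compactin ?\<tau> K \<and> K \<subseteq> A}. emeasure N K)" if A: "A \<in> sets N" for A
  proof (rule antisym)
    let ?A = "\<lambda>i. A \<inter> p -` {i}"
    \<comment> \<open>A Lebesgue set is an F-sigma up to a null set, and an F-sigma of the line is a
      countable union of compact sets.\<close>
    define Q where "Q i F E \<longleftrightarrow> (\<forall>n. compact (F n)) \<and> E \<in> null_sets lebesgue \<and>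
      \<phi> ` ?A i = (\<Union>n. F n) \<union> E" for i and F :: "nat \<Rightarrow> real set" and E
    have "\<exists>F E. Q i F E" for i
    proof -
      obtain B E where BE: "fsigma B" "E \<in> null_sets lebesgue" "B \<union> E = \<phi> ` ?A i"
        by (rule lebesgue_set_almost_fsigma[OF im[OF piece[OF A]]])
      from BE(1) obtain F :: "nat \<Rightarrow> real set" where F: "range F \<subseteq> Collect compact \<and> B = \<Union>(range F)"
        unfolding fsigma_Union_compact by (rule exE)
      have "compact (F n)" for n using F by auto
      moreover have "\<phi> ` ?A i = (\<Union>n. F n) \<union> E" using F BE(3) by simp
      ultimately have "Q i F E" using BE(2) by (simp add: Q_def)
      then show ?thesis by blast
    qed
    then obtain F E where "\<And>i. Q i (F i) (E i)"
      by metis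
    then have F: "\<And>i n. compact (F i n)" "\<And>i. E i \<in> null_sets lebesgue"
      "\<And>i. \<phi> ` ?A i = (\<Union>n. F i n) \<union> E i"
      by (auto simp: Q_def)
    \<comment> \<open>Cutting off at \<open>m\<close> both the pieces and the compact sets within
      each leaves a finite union of compact images, while the sets \<open>D m\<close> still increase
      to almost all of \<open>A\<close>.\<close>
    define D where "D m = {x \<in> A. \<exists>n<m. p x < m \<and> \<phi> x \<in> F (p x) n}" for m
    have Dc: "compactin ?\<tau> (D m)" for m
    proof (rule compactin_pullback_metric[OF inj\<psi>])
      show "D m \<subseteq> space N" using sets.sets_into_space[OF A] by (auto simp: D_def)
      have "\<psi> ` D m = (\<Union>i<m. \<Union>n<m. g i ` F i n)"
      proof
        show "\<psi> ` D m \<subseteq> (\<Union>i<m. \<Union>n<m. g i ` F i n)"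
          by (auto simp: D_def \<psi>_def)
        show "(\<Union>i<m. \<Union>n<m. g i ` F i n) \<subseteq> \<psi> ` D m"
        proof clarify
          fix i n t assume int: "i < m" "n < m" "t \<in> F i n"
          then have "t \<in> \<phi> ` ?A i" unfolding F(3) by auto
          then obtain x where x: "x \<in> A" "p x = i" "\<phi> x = t" by auto
          with int have "x \<in> D m" by (auto simp: D_def)
          then show "g i t \<in> \<psi> ` D m" using x by (intro image_eqI[of _ _ x]) (auto simp: \<psi>_def)
        qed
      qed
      also have "compact \<dots>"
        using F(1) cont by (intro compact_UN finite_lessThan compact_continuous_image)
          (auto intro: continuous_on_subset)
      finally show "compact (\<psi> ` D m)" .
    qed
    have Dsets: "D m \<in> sets N" for m
    proof -
      have "(\<Union>i<m. \<Union>n<m. ?A i \<inter> (\<phi> -` F i n \<inter> space N)) \<in> sets N"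
        by (intro sets.finite_UN sets.Int piece[OF A] measurable_sets[OF \<phi>]
            fmeasurableD[OF lmeasurable_compact] F(1)) auto
      moreover have "D m = (\<Union>i<m. \<Union>n<m. ?A i \<inter> (\<phi> -` F i n \<inter> space N))"
        using sets.sets_into_space[OF A] by (auto simp: D_def)
      ultimately show ?thesis by simp
    qed
    have "A - (\<Union>m. D m) \<in> null_sets N"
    proof (rule null_sets_subset)
      show "(\<Union>i. ?A i \<inter> (\<phi> -` E i \<inter> space N)) \<in> null_sets N"
      proof (rule null_sets_UN)
        fix i
        have S: "?A i \<inter> (\<phi> -` E i \<inter> space N) \<in> sets N"
          by (intro sets.Int piece[OF A] measurable_sets[OF \<phi>] null_setsD2[OF F(2)])
        have "\<phi> ` (?A i \<inter> (\<phi> -` E i \<inter> space N)) \<subseteq> E i" by auto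
        then have "emeasure lebesgue (\<phi> ` (?A i \<inter> (\<phi> -` E i \<inter> space N))) \<le> emeasure lebesgue (E i)"
          by (rule emeasure_mono) (rule null_setsD2[OF F(2)])
        then show "?A i \<inter> (\<phi> -` E i \<inter> space N) \<in> null_sets N"
          using em[OF S] F(2)[of i] S by (auto simp: null_sets_def)
      qed
      show "A - (\<Union>m. D m) \<in> sets N" using A Dsets by blast
      show "A - (\<Union>m. D m) \<subseteq> (\<Union>i. ?A i \<inter> (\<phi> -` E i \<inter> space N))"
      proof
        fix x assume x: "x \<in> A - (\<Union>m. D m)"
        then have "\<phi> x \<in> \<phi> ` ?A (p x)" by blast
        moreover have "\<phi> x \<notin> F (p x) n" for n
        proof
          assume "\<phi> x \<in> F (p x) n"
          then have "x \<in> D (Suc (max n (p x)))"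
            using x unfolding D_def by (auto intro!: exI[of _ n])
          then show False using x by blast
        qed
        ultimately have "\<phi> x \<in> E (p x)" unfolding F(3) by auto
        then show "x \<in> (\<Union>i. ?A i \<inter> (\<phi> -` E i \<inter> space N))"
          using x sets.sets_into_space[OF A] by blast
      qed
    qed
    then have "emeasure N A = emeasure N (A - (A - (\<Union>m. D m)))"
      using A by (simp add: emeasure_Diff_null_set)
    also have "A - (A - (\<Union>m. D m)) = (\<Union>m. D m)" by (auto simp: D_def)
    also have "emeasure N (\<Union>m. D m) = (SUP m. emeasure N (D m))"
    proof (rule SUP_emeasure_incseq[symmetric])
      show "range D \<subseteq> sets N" using Dsets by blast
      show "incseq D" unfolding incseq_def D_def by (auto intro: less_le_trans)
    qed
    also have "\<dots> \<le> (SUP K\<in>{K. compactin ?\<tau> K \<and> K \<subseteq> A}. emeasure N K)"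
      using Dc by (intro SUP_mono) (auto simp: D_def)
    finally show "emeasure N A \<le> (SUP K\<in>{K. compactin ?\<tau> K \<and> K \<subseteq> A}. emeasure N K)" .
    show "(SUP K\<in>{K. compactin ?\<tau> K \<and> K \<subseteq> A}. emeasure N K) \<le> emeasure N A"
      using A by (intro SUP_least emeasure_mono) auto
  qed
  show ?thesis
    unfolding regular_wrt_def Let_def by (intro conjI allI impI ballI) (erule outer inner opsets)+
qed

subsection \<open>Failure of sensitivity\<close>

lemma isomorphic_systems_restrict_conull:
  assumes Z: "Z \<in> sets M" "space M - Z \<in> null_sets M" "T ` Z \<subseteq> Z"
  shows "isomorphic_systems M T (restrict_space M Z) T"
proof -
  let ?N = "restrict_space M Z"
  have sp: "space ?N = Z" using Z(1) by simp
  have Z': "Z \<inter> space M = Z" using sets.sets_into_space[OF Z(1)] by blast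
  have NZ: "restrict_space ?N Z = ?N"
    using restrict_space_whole[of ?N] by (simp add: sp)
  have "the_inv_into Z id \<in> measurable ?N ?N \<longleftrightarrow> id \<in> measurable ?N ?N"
    by (rule measurable_cong) (simp add: sp the_inv_into_f_f[of id Z, simplified])
  then have "iso_mod_null M ?N Z Z id"
    unfolding iso_mod_null_def NZ using Z
    by (auto simp: sp sets_restrict_space_iff Z' id_def distr_id bij_betw_def)
  then show ?thesis
    unfolding isomorphic_systems_def using Z(3) by fastforce
qed

text \<open>The insensitive copy is the restriction of \<open>M\<close> to a forward invariant
  conull set \<open>Z\<close>, with the metric pulled back by \<open>\<psi>\<close>. Points of
  \<open>Z\<close> lie in the support of the image measure, which makes the metric good.\<close>

lemma not_measurably_sensitive:
  fixes u :: "'a \<Rightarrow> real"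
  assumes M: "lebesgue_space M" "nonatomic M" and ns: "nonsingular M T"
    and u: "u \<in> borel_measurable M" "\<And>x. u x \<ge> 0"
    and rec: "AE x in M. \<forall>n. \<bar>u ((T ^^ n) x) - u x\<bar> \<le> \<eta> n" "\<And>e n0. e > 0 \<Longrightarrow> \<exists>n\<ge>n0. \<eta> n < e"
    and acc: "\<And>r. r > 0 \<Longrightarrow> \<not> (AE x in M. \<not> (0 < u x \<and> u x < r))"
  shows "\<not> measurably_sensitive M T"
proof
  assume sens: "measurably_sensitive M T"
  obtain X \<phi> where X: "X \<in> sets M" "space M - X \<in> null_sets M"
    and chart: "lebesgue_chart (restrict_space M X) \<phi>"
    using nonatomic_lebesgue_space_chart[OF M] by blast
  \<comment> \<open>\<open>p\<close> is the index of the shell; \<open>p x = 0\<close> if \<open>u x = 0\<close>, since \<open>1 / 0 = 0\<close>.  The ranges of the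
    \<open>g i\<close> are the intervals between \<open>1 / (i + 2)\<close> and \<open>1 / (i + 1)\<close>.\<close>
  define p where "p x = nat \<lfloor>1 / u x\<rfloor>" for x
  define g where "g i t = 1 / (1 + real i + 1 / (1 + exp t))" for i and t :: real
  define \<psi> where "\<psi> x = g (p x) (\<phi> x)" for x
  have p_meas: "p \<in> measurable M (count_space UNIV)"
    unfolding p_def using u(1) by measurable
  have cont: "continuous_on UNIV (g i)" for i
    unfolding g_def
    by (intro continuous_intros) (auto simp: add_pos_pos less_imp_neq[symmetric] add_nonneg_pos)
  \<comment> \<open>The reciprocal of \<open>g i t\<close> is \<open>i + 1\<close> plus a number
    strictly between 0 and 1: its integer part recovers \<open>i\<close>, its fractional part
    \<open>t\<close>.\<close>
  have g_inj: "i = j \<and> s = t" if "g i s = g j t" for i j s t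
  proof -
    define a b where "a = 1 / (1 + exp s)" and "b = 1 / (1 + exp t)"
    have ab: "0 < a" "a < 1" "0 < b" "b < 1"
      by (auto simp: a_def b_def add_pos_pos)
    have "real i + a = real j + b"
      using that ab unfolding g_def a_def[symmetric] b_def[symmetric] by (simp add: field_simps)
    moreover from this have "i = j" using ab by linarith
    ultimately have "a = b" by simp
    then have "exp s = exp t"
      unfolding a_def b_def by (simp add: divide_eq_eq add_pos_pos less_imp_neq[symmetric])
    with \<open>i = j\<close> show ?thesis by simp
  qed
  have g_pos: "g i t > 0" for i t
    unfolding g_def by (simp add: add_pos_pos add_nonneg_pos)
  \<comment> \<open>The range of \<open>g\<close> at index \<open>p x\<close> ends at
    \<open>1 / (1 + p x)\<close>, exactly where the shell of \<open>x\<close> begins.\<close>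
  have \<psi>_le: "0 < \<psi> x \<and> \<psi> x \<le> u x" if "u x > 0" for x
  proof -
    have "1 / u x < 1 + real (p x)"
      using u(2)[of x] unfolding p_def by linarith
    then have "1 / (1 + real (p x)) < u x" using that by (simp add: field_simps)
    moreover have "\<psi> x \<le> 1 / (1 + real (p x))"
      unfolding \<psi>_def g_def by (intro divide_left_mono) (auto simp: add_pos_pos add_nonneg_pos)
    ultimately show ?thesis using g_pos unfolding \<psi>_def by (meson less_imp_le order.trans)
  qed
  have \<psi>_meas: "\<psi> \<in> borel_measurable (restrict_space M X)"
    unfolding \<psi>_def using cont chart measurable_restrict_space1[OF p_meas]
    by (intro measurable_piecewise_chart) (auto simp: lebesgue_chart_def)
  define I where "I a b = {x \<in> X. a < \<psi> x \<and> \<psi> x < b}" for a b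
  have I: "I a b \<in> sets M" for a b
  proof -
    have "{x \<in> space (restrict_space M X). a < \<psi> x \<and> \<psi> x < b} \<in> sets (restrict_space M X)"
      using \<psi>_meas by measurable
    moreover have "X \<inter> space M = X" using sets.sets_into_space[OF X(1)] by blast
    ultimately show ?thesis using X(1) by (simp add: I_def sets_restrict_space_iff)
  qed
  have AEX: "AE x in M. x \<in> X"
    using AE_not_in[OF X(2)] AE_space by eventually_elim auto
  \<comment> \<open>Almost every point lies in the support of the pushforward of the measure under \<open>\<psi>\<close>.\<close>
  have "AE x in M. \<forall>a\<in>\<rat>. \<forall>b\<in>\<rat>. x \<in> I a b \<longrightarrow> emeasure M (I a b) > 0"
  proof -
    have "AE x in M. x \<in> I a b \<longrightarrow> emeasure M (I a b) > 0" for a b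
    proof (cases "emeasure M (I a b) = 0")
      case True
      then have "I a b \<in> null_sets M" using I by auto
      from AE_not_in[OF this] show ?thesis by eventually_elim simp
    qed (simp add: zero_less_iff_neq_zero)
    then show ?thesis by (simp add: AE_ball_countable countable_rat)
  qed
  with AEX rec(1) have "AE x in M. x \<in> X \<and> (\<forall>a\<in>\<rat>. \<forall>b\<in>\<rat>. x \<in> I a b \<longrightarrow> emeasure M (I a b) > 0) \<and>
      (\<forall>n. \<bar>u ((T ^^ n) x) - u x\<bar> \<le> \<eta> n)"
    by eventually_elim simp
  then obtain Z where Z: "Z \<in> sets M" "space M - Z \<in> null_sets M" "T ` Z \<subseteq> Z"
    and ZP: "\<And>x. x \<in> Z \<Longrightarrow> x \<in> X \<and> (\<forall>a\<in>\<rat>. \<forall>b\<in>\<rat>. x \<in> I a b \<longrightarrow> emeasure M (I a b) > 0) \<and>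
      (\<forall>n. \<bar>u ((T ^^ n) x) - u x\<bar> \<le> \<eta> n)"
    by (rule nonsingular_forward_invariant_set[OF ns]) blast
  define N where "N = restrict_space M Z"
  define d where "d = (\<lambda>x y. \<bar>\<psi> x - \<psi> y\<bar>)"
  have spN: "space N = Z" using Z(1) by (simp add: N_def)
  have Zsp: "Z \<inter> space M = Z" using sets.sets_into_space[OF Z(1)] by blast
  have ZX: "Z \<subseteq> X" using ZP by blast
  have Xsp: "X \<inter> space M = X" using sets.sets_into_space[OF X(1)] by blast
  have chartN: "lebesgue_chart N \<phi>"
  proof -
    have "restrict_space (restrict_space M X) Z = N"
      unfolding N_def using Z(1) X(1) ZX by (simp add: restrict_restrict_space Int_absorb1)
    moreover have "Z \<in> sets (restrict_space M X)"
      using Z(1) ZX Xsp X(1) by (simp add: sets_restrict_space_iff)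
    ultimately show ?thesis using lebesgue_chart_restrict[OF chart] by metis
  qed
  have inj\<psi>: "inj_on \<psi> Z"
    using chartN g_inj unfolding \<psi>_def inj_on_def lebesgue_chart_def spN by metis
  interpret Metric_space Z d
    unfolding d_def using inj\<psi> by (rule pullback_Metric_space)
  have good: "good_metric N d"
    unfolding good_metric_def spN
  proof (intro conjI allI impI)
    show "Metric_space Z d" ..
    show "regular_wrt N d"
      unfolding d_def \<psi>_def
    proof (rule regular_wrt_piecewise_chart[OF chartN _ cont g_inj])
      show "p \<in> measurable N (count_space UNIV)"
        unfolding N_def using p_meas by (rule measurable_restrict_space1)
    qed
    fix U assume U: "openin mtopology U \<and> U \<noteq> {}"
    then obtain W where W: "open W" "U = Z \<inter> \<psi> -` W"
      using openin_pullback_metric_iff[OF inj\<psi>, of U] unfolding d_def by auto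
    obtain x where x: "x \<in> Z" "\<psi> x \<in> W" using U W(2) by blast
    obtain e where e: "e > 0" "ball (\<psi> x) e \<subseteq> W"
      using W(1) x(2) by (rule openE)
    \<comment> \<open>The endpoints must be rational, because positivity was secured only for
      countably many intervals.\<close>
    obtain a where a: "a \<in> \<rat>" "\<psi> x - e < a" "a < \<psi> x"
      using Rats_dense_in_real[of "\<psi> x - e" "\<psi> x"] e(1) by auto
    obtain b where b: "b \<in> \<rat>" "\<psi> x < b" "b < \<psi> x + e"
      using Rats_dense_in_real[of "\<psi> x" "\<psi> x + e"] e(1) by auto
    have "x \<in> I a b" using x ZX a b by (auto simp: I_def)
    then have pos: "emeasure M (I a b) > 0" using ZP x(1) a(1) b(1) by blast
    have IU: "Z \<inter> I a b \<subseteq> U"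
    proof
      fix y assume y: "y \<in> Z \<inter> I a b"
      then have "\<psi> y \<in> ball (\<psi> x) e" using a b by (auto simp: I_def dist_real_def)
      then show "y \<in> U" using e(2) W(2) y by blast
    qed
    have "emeasure M (I a b) = emeasure M (I a b - (space M - Z))"
      using I Z(2) by (rule emeasure_Diff_null_set[symmetric, rotated])
    also have "I a b - (space M - Z) = Z \<inter> I a b"
      using sets.sets_into_space[OF I] by blast
    also have "emeasure M (Z \<inter> I a b) = emeasure N (Z \<inter> I a b)"
      unfolding N_def using Z(1) Zsp by (simp add: emeasure_restrict_space)
    also have "\<dots> \<le> emeasure N U"
    proof (rule emeasure_mono[OF IU])
      show "U \<in> sets N"
        using \<open>regular_wrt N d\<close> U unfolding regular_wrt_def Let_def spN by blast
    qed
    finally show "emeasure N U > 0" using pos by simp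
  qed
  have T: "T \<in> measurable N N"
    unfolding N_def using ns Z(3)
    by (intro measurable_restrict_space2 measurable_restrict_space1)
      (auto simp: nonsingular_def space_restrict_space)
  have iso: "isomorphic_systems M T N T"
    unfolding N_def using Z by (rule isomorphic_systems_restrict_conull)
  obtain \<delta> where \<delta>: "\<delta> > 0"
    "\<forall>x\<in>Z. \<forall>\<epsilon>>0. \<exists>n0. \<forall>n\<ge>n0. emeasure N {y \<in> mball x \<epsilon>. d ((T ^^ n) x) ((T ^^ n) y) > \<delta>} > 0"
    using sens T iso good unfolding measurably_sensitive_def spN[symmetric] by meson
  \<comment> \<open>The bound \<open>1/2\<close> puts \<open>x\<close> outside shell 0, and
    \<open>\<delta> / 4\<close> yields \<open>2 / i \<le> 4 / (i + 1) < \<delta>\<close> for the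
    index \<open>i\<close> of its shell.\<close>
  have "\<exists>x\<in>Z. 0 < u x \<and> u x < min (1/2) (\<delta> / 4)"
  proof (rule ccontr)
    assume "\<not> ?thesis"
    moreover have "AE x in M. x \<in> Z"
      using AE_not_in[OF Z(2)] AE_space by eventually_elim auto
    ultimately have "AE x in M. \<not> (0 < u x \<and> u x < min (1/2) (\<delta> / 4))"
      by (auto elim: eventually_mono)
    then show False using acc[of "min (1/2) (\<delta> / 4)"] \<delta>(1) by auto
  qed
  then obtain x where x: "x \<in> Z" "0 < u x" "u x < 1/2" "u x < \<delta> / 4" by auto
  define i where "i = p x"
  have bounds: "1 / (i + 1) < u y \<and> u y \<le> 1 / i" if "p y = i" "i \<ge> 1" for y
  proof -
    have "u y \<noteq> 0" using that by (auto simp: p_def)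
    then have "u y > 0" using u(2)[of y] by simp
    moreover have "real i \<le> 1 / u y" "1 / u y < real i + 1"
      using that unfolding p_def by linarith+
    ultimately show ?thesis using that(2) by (simp add: field_simps)
  qed
  have "2 < 1 / u x" using x by (simp add: field_simps)
  then have i: "i \<ge> 1" unfolding i_def p_def by linarith
  have i\<delta>: "2 / i < \<delta>"
  proof -
    have "1 / (i + 1) < \<delta> / 4" using bounds[of x] i x(4) by (simp add: i_def)
    moreover have "2 / real i \<le> 4 * (1 / (i + 1))" using i by (simp add: field_simps)
    ultimately show ?thesis by linarith
  qed
  \<comment> \<open>An open range means that a small enough ball about \<open>x\<close> stays inside
    the shell of \<open>x\<close>.\<close>
  have "open (range (g i))"
    using injective_eq_1d_open_map_UNIV[OF cont[of i]] g_inj by (auto simp: inj_on_def)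
  moreover have "\<psi> x \<in> range (g i)" by (auto simp: \<psi>_def i_def)
  ultimately obtain \<epsilon> where \<epsilon>: "\<epsilon> > 0" "ball (\<psi> x) \<epsilon> \<subseteq> range (g i)" by (rule openE)
  obtain n0 where n0: "\<forall>n\<ge>n0. emeasure N {y \<in> mball x \<epsilon>. d ((T ^^ n) x) ((T ^^ n) y) > \<delta>} > 0"
    using \<delta>(2) x(1) \<epsilon>(1) by blast
  \<comment> \<open>The bound is the lower end of shell \<open>i\<close>, so \<open>u\<close> stays
    positive at time \<open>n\<close>. This matters because points with \<open>u = 0\<close> have
    \<open>p = 0\<close>, and \<open>\<psi>\<close> keeps them away from 0.\<close>
  obtain n where n: "n \<ge> n0" "\<eta> n < 1 / (i + 1)"
    using rec(2)[of "1 / (i + 1)" n0] by auto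
  have orbit: "0 < \<psi> ((T ^^ n) y) \<and> \<psi> ((T ^^ n) y) \<le> 2 / i" if "y \<in> Z" "p y = i" for y
  proof -
    have "\<bar>u ((T ^^ n) y) - u y\<bar> \<le> \<eta> n" using ZP[OF that(1)] by blast
    then have "\<bar>u ((T ^^ n) y) - u y\<bar> < 1 / (i + 1)" using n(2) by simp
    moreover have "1 / real (i + 1) \<le> 1 / i" using i by (simp add: field_simps)
    moreover have "2 / real i = 1 / i + 1 / i" by simp
    ultimately have "0 < u ((T ^^ n) y)" "u ((T ^^ n) y) \<le> 2 / i"
      using bounds[OF that(2) i] by linarith+
    then show ?thesis using \<psi>_le[of "(T ^^ n) y"] by linarith
  qed
  \<comment> \<open>At time \<open>n\<close> both values of \<open>\<psi>\<close> are positive and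
    at most \<open>2 / i\<close>, so they differ by less than \<open>\<delta>\<close>.\<close>
  have "d ((T ^^ n) x) ((T ^^ n) y) < \<delta>" if y: "y \<in> mball x \<epsilon>" for y
  proof -
    have yZ: "y \<in> Z" "d x y < \<epsilon>" using y by auto
    then have "\<psi> y \<in> ball (\<psi> x) \<epsilon>" by (simp add: d_def dist_real_def)
    then have "\<psi> y \<in> range (g i)" using \<epsilon>(2) by blast
    then have "p y = i" unfolding \<psi>_def using g_inj by blast
    then show ?thesis
      using orbit[OF x(1)] orbit[OF yZ(1)] i\<delta> by (auto simp: d_def i_def)
  qed
  then have "{y \<in> mball x \<epsilon>. d ((T ^^ n) x) ((T ^^ n) y) > \<delta>} = {}"
    using order.asym by blast
  then have "emeasure N {} > 0" using n0 n(1) by metis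
  then show False by simp
qed

theorem corollary3p4:
  fixes M :: "'a measure" and T :: "'a \<Rightarrow> 'a"
  assumes "lebesgue_space M" and "nonatomic M"
    and "sigma_finite_measure M" and "emeasure M (space M) > 0"
    and "nonsingular M T" and "ergodic M T" and "measurably_sensitive M T"
  shows "finite {l. eigenvalue M T l}"
proof (rule ccontr)
  assume "infinite {l. eigenvalue M T l}"
  then obtain u :: "'a \<Rightarrow> real" and \<eta> where "u \<in> borel_measurable M" "\<And>x. u x \<ge> 0"
    "AE x in M. \<forall>n. \<bar>u ((T ^^ n) x) - u x\<bar> \<le> \<eta> n"
    "\<And>e n0. e > 0 \<Longrightarrow> \<exists>n\<ge>n0. \<eta> n < e"
    "\<And>r. r > 0 \<Longrightarrow> \<not> (AE x in M. \<not> (0 < u x \<and> u x < r))"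
    using almost_recurrent_function[OF assms(5) assms(4)] by blast
  then have "\<not> measurably_sensitive M T"
    by (rule not_measurably_sensitive[OF assms(1,2,5)])
  then show False using assms(7) by simp
qed

end
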